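(* Each zero-dimensional separable Rosenthal compact space $K$ is homeomorphic to a compact subset of the function space $SC_p(\omega^\omega)$.
   Context: A function $f:X\to Y$ between topological spaces is scatteredly continuous if for each non-empty subspace $A\subset X$ the restriction $f|A:A\to Y$ has a point of continuity. $SC_p(X)\subset\mathbb R^X$ denotes the linear space of all scatteredly continuous real-valued functions on $X$, endowed with the topology of pointwise convergence. Here $\omega^\omega$ is the countable power of the discrete space $\omega$ with the product topology (the space of irrationals). A topological space $K$ is Rosenthal compact if $K$ is homeomorphic to a compact subspace of the space $\mathcal B_1(X)\subset\mathbb R^X$ of functions of the first Baire class (pointwise limits of sequences of continuous real-valued functions), with the topology of pointwise convergence, on some Polish space $X$. A compact (Hausdorff) space is zero-dimensional if it has a base of clopen sets. *)

theory Defs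
  imports "HOL-Analysis.Analysis"
begin

definition polish :: "'a topology \<Rightarrow> bool"
  where "polish X \<longleftrightarrow> completely_metrizable_space X \<and> separable_space X"

definition has_clopen_base :: "'a topology \<Rightarrow> bool"
  where "has_clopen_base X \<longleftrightarrow>
    (\<exists>\<B>. (\<forall>V\<in>\<B>. openin X V \<and> closedin X V) \<and>
         (\<forall>U x. openin X U \<and> x \<in> U \<longrightarrow> (\<exists>V\<in>\<B>. x \<in> V \<and> V \<subseteq> U)))"

definition scatteredly_continuous :: "'a topology \<Rightarrow> 'b topology \<Rightarrow> ('a \<Rightarrow> 'b) \<Rightarrow> bool"
  where "scatteredly_continuous X Y f \<longleftrightarrow>
    f \<in> topspace X \<rightarrow> topspace Y \<and>
    (\<forall>A. A \<subseteq> topspace X \<and> A \<noteq> {} \<longrightarrow>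
       (\<exists>a\<in>A. topcontinuous_at (subtopology X A) Y f a))"

definition baire_one :: "'a topology \<Rightarrow> ('a \<Rightarrow> real) \<Rightarrow> bool"
  where "baire_one X f \<longleftrightarrow>
    (\<exists>g :: nat \<Rightarrow> 'a \<Rightarrow> real. (\<forall>n. continuous_map X euclideanreal (g n)) \<and>
       (\<forall>x\<in>topspace X. (\<lambda>n. g n x) \<longlonglongrightarrow> f x))"

text \<open>
  A function on the space \<open>X\<close> is represented by its extension with value \<^const>\<open>undefined\<close>
  outside \<open>topspace X\<close>; these extensions are exactly the points of
  \<open>powertop_real (topspace X)\<close>, which carries the topology of pointwise convergence.
\<close>

definition SC\<^sub>p :: "'a topology \<Rightarrow> ('a \<Rightarrow> real) topology"
  where "SC\<^sub>p X =
    subtopology (powertop_real (topspace X)) {f. scatteredly_continuous X euclideanreal f}"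

definition Baire_one_space :: "'a topology \<Rightarrow> ('a \<Rightarrow> real) topology"
  where "Baire_one_space X = subtopology (powertop_real (topspace X)) {f. baire_one X f}"

definition embeds_as_compact_subset :: "'a topology \<Rightarrow> 'b topology \<Rightarrow> bool"
  where "embeds_as_compact_subset K Y \<longleftrightarrow>
    (\<exists>C. compactin Y C \<and> K homeomorphic_space subtopology Y C)"

text \<open>
  HOL cannot quantify over the type of points of the witnessing Polish space inside a formula,
  so that type is a parameter. As a hypothesis with the parameter a free type variable, this
  covers Polish spaces on all types.
\<close>

definition rosenthal_compact :: "'x itself \<Rightarrow> 'a topology \<Rightarrow> bool"
  where "rosenthal_compact (_ :: 'x itself) K \<longleftrightarrow>
    (\<exists>X :: 'x topology. polish X \<and> embeds_as_compact_subset K (Baire_one_space X))"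

definition Baire_space :: "(nat \<Rightarrow> nat) topology"
  where "Baire_space = product_topology (\<lambda>_. discrete_topology UNIV) UNIV"

end

theory Submission
  imports Defs
begin

text \<open>
  Let \<open>K \<subseteq> B\<^sub>1(X)\<close> have the dense sequence \<open>d\<close>. By compactness, a clopen \<open>U \<subseteq> K\<close> is separated from its
  complement by finitely many points \<open>x\<^sub>0, \<dots>, x\<^sub>n\<close> of \<open>X\<close>: for \<open>u \<in> U\<close> and \<open>w \<notin> U\<close> some
  \<open>\<bar>u(x\<^sub>l) - w(x\<^sub>l)\<bar>\<close> is at least \<open>1/(n+1)\<close>. So \<open>U\<close> is coded by \<open>n\<close>, the points \<open>x\<^sub>l\<close> and
  \<open>J = {j. d\<^sub>j \<in> U}\<close>. Since Baire-one functions pull closed sets back to \<open>G\<^sub>\<delta>\<close> sets, the codes form a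
  \<open>G\<^sub>\<delta>\<close> subset of a Polish space, and for fixed \<open>k \<in> K\<close> the codes of clopen sets containing \<open>k\<close>, and
  likewise of those missing \<open>k\<close>, are \<open>G\<^sub>\<delta>\<close>. By the Baire category theorem a two-valued function with
  \<open>G\<^sub>\<delta>\<close> fibres on a Polish space is scatteredly continuous. Pulling these functions back along a
  continuous surjection from the Baire space onto the space of codes embeds \<open>K\<close>.
\<close>

section \<open>G-delta sets and functions of the first Baire class\<close>

lemma gdelta_in_continuous_map_preimage:
  assumes "continuous_map X Y f" "gdelta_in Y S"
  shows "gdelta_in X {x \<in> topspace X. f x \<in> S}"
proof -
  obtain C where C: "\<And>n::nat. openin Y (C n)" "\<Inter>(range C) = S"
    using assms(2) unfolding gdelta_in_descending by blast
  have "gdelta_in X (\<Inter>n. {x \<in> topspace X. f x \<in> C n})"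
    using openin_continuous_map_preimage[OF assms(1) C(1)]
    by (intro gdelta_in_Inter) (auto intro: open_imp_gdelta_in)
  moreover have "(\<Inter>n. {x \<in> topspace X. f x \<in> C n}) = {x \<in> topspace X. f x \<in> S}"
    using C(2) by auto
  ultimately show ?thesis by simp
qed

lemma gdelta_in_finite_UN:
  assumes "finite I" "\<And>i. i \<in> I \<Longrightarrow> gdelta_in X (S i)"
  shows "gdelta_in X (\<Union>i\<in>I. S i)"
  using assms by (induction I) (auto intro: gdelta_in_Un)

lemma baire_one_compose:
  assumes "continuous_map Y X h" "baire_one X f"
  shows "baire_one Y (\<lambda>y. f (h y))"
proof -
  obtain g where g: "\<And>n::nat. continuous_map X euclideanreal (g n)"
    "\<And>x. x \<in> topspace X \<Longrightarrow> (\<lambda>n. g n x) \<longlonglongrightarrow> f x"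
    using assms(2) unfolding baire_one_def by blast
  have "continuous_map Y euclideanreal (\<lambda>y. g n (h y))" for n
    using continuous_map_compose[OF assms(1) g(1)] by (simp add: o_def)
  moreover have "(\<lambda>n. g n (h y)) \<longlonglongrightarrow> f (h y)" if "y \<in> topspace Y" for y
    using g(2) assms(1) that by (auto simp: continuous_map_def)
  ultimately show ?thesis
    unfolding baire_one_def by (intro exI[of _ "\<lambda>n y. g n (h y)"]) auto
qed

lemma baire_one_abs_diff:
  assumes "baire_one X f" "baire_one X g"
  shows "baire_one X (\<lambda>x. \<bar>f x - g x\<bar>)"
proof -
  obtain u v where
    u: "\<And>n::nat. continuous_map X euclideanreal (u n)"
       "\<And>x. x \<in> topspace X \<Longrightarrow> (\<lambda>n. u n x) \<longlonglongrightarrow> f x" and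
    v: "\<And>n::nat. continuous_map X euclideanreal (v n)"
       "\<And>x. x \<in> topspace X \<Longrightarrow> (\<lambda>n. v n x) \<longlonglongrightarrow> g x"
    using assms unfolding baire_one_def by blast
  show ?thesis
    unfolding baire_one_def
    by (intro exI[of _ "\<lambda>n x. \<bar>u n x - v n x\<bar>"] conjI allI ballI
        continuous_map_real_abs continuous_map_diff tendsto_rabs tendsto_diff u v)
qed

text \<open>With \<open>g n\<close> converging to \<open>f\<close>, \<open>c\<close> is at most
  \<open>f x\<close> iff for all \<open>k\<close> and \<open>N\<close> some \<open>n\<close> beyond
  \<open>N\<close> has \<open>g n x\<close> above \<open>c - 1/(k+1)\<close>. For fixed
  \<open>k\<close> and \<open>N\<close> this is an open condition because the inequality is strict,
  and there are countably many pairs.\<close>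

lemma gdelta_in_baire_one_ge:
  assumes "baire_one X f"
  shows "gdelta_in X {x \<in> topspace X. c \<le> f x}"
proof -
  obtain g where g: "\<And>n::nat. continuous_map X euclideanreal (g n)"
    "\<And>x. x \<in> topspace X \<Longrightarrow> (\<lambda>n. g n x) \<longlonglongrightarrow> f x"
    using assms unfolding baire_one_def by blast
  define O1 where "O1 k N = (\<Union>n\<in>{N..}. {x \<in> topspace X. g n x \<in> {c - inverse (Suc k)<..}})"
    for k N :: nat
  have "openin X (O1 k N)" for k N
    unfolding O1_def
    by (rule openin_Union) (auto intro!: openin_continuous_map_preimage[OF g(1)] simp del: greaterThan_iff)
  then have "gdelta_in X (\<Inter>kN. case_prod O1 kN)"
    by (intro gdelta_in_Inter) (auto intro: open_imp_gdelta_in)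
  moreover have "(\<Inter>kN. case_prod O1 kN) = {x \<in> topspace X. c \<le> f x}"
  proof (intro equalityI subsetI)
    fix x assume x: "x \<in> (\<Inter>kN. case_prod O1 kN)"
    then have xO: "x \<in> O1 k N" for k N by fastforce
    then have X: "x \<in> topspace X" unfolding O1_def by blast
    have "c - inverse (Suc k) \<le> f x" for k
    proof (rule ccontr)
      assume "\<not> ?thesis"
      then have "\<forall>\<^sub>F n in sequentially. g n x < c - inverse (Suc k)"
        using order_tendstoD(2)[OF g(2)[OF X]] by auto
      then obtain N where "\<And>n. n \<ge> N \<Longrightarrow> g n x < c - inverse (Suc k)"
        unfolding eventually_sequentially by blast
      with xO[of k N] show False unfolding O1_def by force
    qed
    moreover have "(\<lambda>k. c - inverse (Suc k)) \<longlonglongrightarrow> c - 0"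
      by (intro tendsto_intros LIMSEQ_inverse_real_of_nat)
    ultimately have "c \<le> f x"
      by (intro LIMSEQ_le_const2[of "\<lambda>k. c - inverse (Suc k)" c]) auto
    with X show "x \<in> {x \<in> topspace X. c \<le> f x}" by simp
  next
    fix x assume x: "x \<in> {x \<in> topspace X. c \<le> f x}"
    have "x \<in> O1 k N" for k N
    proof -
      have "c - inverse (Suc k) < f x"
        using x by (smt (verit) mem_Collect_eq of_nat_0_less_iff positive_imp_inverse_positive zero_less_Suc)
      then have "\<forall>\<^sub>F n in sequentially. c - inverse (Suc k) < g n x"
        using order_tendstoD(1)[OF g(2)] x by auto
      then obtain M where "\<And>n. n \<ge> M \<Longrightarrow> c - inverse (Suc k) < g n x"
        unfolding eventually_sequentially by blast
      then have "c - inverse (Suc k) < g (max M N) x" by simp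
      then show ?thesis using x unfolding O1_def by force
    qed
    then show "x \<in> (\<Inter>kN. case_prod O1 kN)" by auto
  qed
  ultimately show ?thesis by simp
qed

section \<open>Baire category and scattered continuity\<close>

text \<open>If both were dense, the open sets whose intersections are \<open>P\<close> and
  \<open>Q\<close> would form a countable family of dense open sets with empty intersection, against
  the Baire category theorem.\<close>

lemma disjoint_gdelta_not_both_dense:
  assumes X: "completely_metrizable_space X" "topspace X \<noteq> {}"
    and P: "gdelta_in X P" and Q: "gdelta_in X Q" and PQ: "P \<inter> Q = {}"
  shows "X closure_of P \<noteq> topspace X \<or> X closure_of Q \<noteq> topspace X"
proof (rule ccontr)
  assume "\<not> ?thesis"
  then have dense: "X closure_of P = topspace X" "X closure_of Q = topspace X" by auto
  obtain C D where C: "\<And>n::nat. openin X (C n)" "\<Inter>(range C) = P"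
    and D: "\<And>n::nat. openin X (D n)" "\<Inter>(range D) = Q"
    using P Q unfolding gdelta_in_descending by metis
  have "X closure_of C n = topspace X" "X closure_of D n = topspace X" for n
    using dense closure_of_mono[of P "C n" X] closure_of_mono[of Q "D n" X] C(2) D(2)
      closure_of_subset_topspace[of X "C n"] closure_of_subset_topspace[of X "D n"]
    by (metis INF_lower UNIV_I subset_antisym)+
  then have "X closure_of \<Inter>(range C \<union> range D) = topspace X"
    using C(1) D(1) X(1) by (intro Baire_category) auto
  moreover have "\<Inter>(range C \<union> range D) = {}"
    using C(2) D(2) PQ by auto
  ultimately show False using X(2) by simp
qed

text \<open>The closure \<open>B\<close> of \<open>A\<close> is completely metrizable even if
  \<open>A\<close> is not. The two fibres are disjoint G-delta sets in \<open>B\<close>, so one of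
  them misses a nonempty open subset of \<open>B\<close>. That subset meets \<open>A\<close>, by
  density, and on the part in \<open>A\<close> the function is constant.\<close>

lemma scatteredly_continuous_indicator:
  fixes f :: "'a \<Rightarrow> real"
  assumes X: "completely_metrizable_space X"
    and f: "\<And>x. x \<in> topspace X \<Longrightarrow> f x \<in> {0, 1}"
    and g: "\<And>c. c \<in> {0, 1} \<Longrightarrow> gdelta_in X {x \<in> topspace X. f x = c}"
  shows "scatteredly_continuous X euclideanreal f"
  unfolding scatteredly_continuous_def
proof (intro conjI allI impI)
  show "f \<in> topspace X \<rightarrow> topspace euclideanreal" by simp
  fix A assume A: "A \<subseteq> topspace X \<and> A \<noteq> {}"
  define B where "B = X closure_of A"
  have AB: "A \<subseteq> B" "B \<subseteq> topspace X"
    using A closure_of_subset closure_of_subset_topspace unfolding B_def by metis+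
  define Y where "Y = subtopology X B"
  have Y: "completely_metrizable_space Y" "topspace Y = B"
    using X AB unfolding Y_def B_def
    by (auto intro: completely_metrizable_space_closedin)
  have "gdelta_in Y {x \<in> B. f x = c}" if "c \<in> {0, 1}" for c
    unfolding Y_def gdelta_in_subtopology using g[OF that] AB by blast
  then have "Y closure_of {x \<in> B. f x = 0} \<noteq> topspace Y \<or> Y closure_of {x \<in> B. f x = 1} \<noteq> topspace Y"
    using Y A AB by (intro disjoint_gdelta_not_both_dense) auto
  then obtain c where c: "c \<in> {0, 1}" "Y closure_of {x \<in> B. f x = c} \<noteq> B"
    using Y(2) by blast
  then obtain b where b: "b \<in> B" "b \<notin> Y closure_of {x \<in> B. f x = c}"
    using closure_of_subset_topspace[of Y] Y(2) by blast
  then obtain V where V: "openin Y V" "b \<in> V" "V \<inter> {x \<in> B. f x = c} = {}"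
    using Y(2) unfolding in_closure_of by blast
  then obtain U where U: "openin X U" "V = U \<inter> B"
    unfolding Y_def openin_subtopology by blast
  then obtain a where a: "a \<in> A" "a \<in> U"
    using V(2) b(1) unfolding B_def in_closure_of by blast
  have const: "f y = 1 - c" if "y \<in> U \<inter> A" for y
  proof -
    have "y \<in> B" "y \<in> topspace X" using that AB by auto
    then have "f y \<noteq> c" "f y \<in> {0, 1}" using that V(3) U(2) f by auto
    then show ?thesis using c(1) by auto
  qed
  have "topcontinuous_at (subtopology X A) euclideanreal f a"
    unfolding topcontinuous_at_def
  proof (intro conjI allI impI)
    show "a \<in> topspace (subtopology X A)" using a A by auto
    fix W assume "openin euclideanreal W \<and> f a \<in> W"
    then show "\<exists>U. openin (subtopology X A) U \<and> a \<in> U \<and> (\<forall>y\<in>U. f y \<in> W)"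
      using const a U(1) by (intro exI[of _ "U \<inter> A"]) (auto simp: openin_subtopology)
  qed simp
  then show "\<exists>a\<in>A. topcontinuous_at (subtopology X A) euclideanreal f a"
    using a by blast
qed

section \<open>Polish spaces as continuous images of the Baire space\<close>

text \<open>Makes second countability of the Baire space and of its countable power available from
  the type class instances.\<close>

lemma Baire_space_eq_euclidean: "Baire_space = euclidean"
proof -
  have "discrete_topology (UNIV :: nat set) = euclidean"
    by (auto simp: topology_eq open_discrete)
  then show ?thesis
    unfolding Baire_space_def by (simp add: euclidean_product_topology)
qed

lemma topspace_Baire_space [simp]: "topspace Baire_space = UNIV"
  by (simp add: Baire_space_eq_euclidean)

lemma completely_metrizable_Baire_space: "completely_metrizable_space Baire_space"
  unfolding Baire_space_def
  by (auto simp: completely_metrizable_space_product_topology completely_metrizable_space_discrete_topology)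

lemma second_countable_euclidean: "second_countable (euclidean :: 'a::second_countable_topology topology)"
proof -
  obtain B :: "'a set set" where "countable B" "topological_basis B"
    using ex_countable_basis by blast
  then show ?thesis
    unfolding second_countable_def
    using topological_basis_open[of B] topological_basisE[of B]
    by (metis open_openin)
qed

lemma polish_gdelta_in:
  fixes G :: "'a::second_countable_topology set"
  assumes "completely_metrizable_space (euclidean :: 'a topology)" "gdelta_in euclidean G"
  shows "polish (subtopology euclidean G)"
  unfolding polish_def
  using assms completely_metrizable_space_gdelta_in second_countable_euclidean
    second_countable_imp_separable_space second_countable_subtopology by blast

lemma openin_Baire_space_cylinder: "openin Baire_space {z'. \<forall>i\<le>n. z' i = z i}"
proof -
  have "openin Baire_space (\<Pi>\<^sub>E i\<in>UNIV. if i \<le> n then {z i} else UNIV)"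
    unfolding Baire_space_def by (rule product_topology_basis) auto
  moreover have "(\<Pi>\<^sub>E i\<in>UNIV. if i \<le> n then {z i} else UNIV) = {z'. \<forall>i\<le>n. z' i = z i}"
    by (auto simp: PiE_iff split: if_splits)
  ultimately show ?thesis by simp
qed

text \<open>A sequence \<open>z\<close> proposes points \<open>q (z 0)\<close>,
  \<open>q (z 1)\<close>, ... of a dense sequence. The walk \<open>w z\<close> moves to a proposal
  only if the jump is short enough, so it is always Cauchy, and \<open>h z\<close> is its
  limit.\<close>

lemma (in Metric_space) Baire_space_surjection:
  assumes comp: "mcomplete" and sep: "separable_space mtopology" and ne: "M \<noteq> {}"
  obtains h where "continuous_map Baire_space mtopology h" "range h = M"
proof -
  obtain C where C: "countable C" "C \<subseteq> M" "mtopology closure_of C = M"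
    using sep unfolding separable_space_def by auto
  then have "C \<noteq> {}" using ne by auto
  define q where "q = from_nat_into C"
  have qM: "q i \<in> M" for i
    using C \<open>C \<noteq> {}\<close> from_nat_into unfolding q_def by blast
  have qdense: "\<exists>i. d x (q i) < e" if "x \<in> M" "e > 0" for x e
  proof -
    have "\<exists>y\<in>C. y \<in> mball x e"
      using C(3) that unfolding metric_closure_of by blast
    then show ?thesis
      using C(1) from_nat_into_surj unfolding q_def by (metis in_mball)
  qed
  \<comment> \<open>Staying put at a rejected proposal makes the walk defined on every
    \<open>z\<close>, so that \<open>h\<close> lives on the whole Baire space and not only on a
    closed subset.\<close>
  define w where "w z = rec_nat (q (z 0)) (\<lambda>n y. if d y (q (z (Suc n))) \<le> (1/2)^n then q (z (Suc n)) else y)"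
    for z :: "nat \<Rightarrow> nat"
  have w0: "w z 0 = q (z 0)" and
    wS: "w z (Suc n) = (if d (w z n) (q (z (Suc n))) \<le> (1/2)^n then q (z (Suc n)) else w z n)" for z n
    unfolding w_def by auto
  have wM: "w z n \<in> M" for z n
    by (induction n) (auto simp: w0 wS qM)
  have step: "d (w z n) (w z (Suc n)) \<le> (1/2)^n" for z n
    by (auto simp: wS wM)
  \<comment> \<open>The partial sum of the geometric series is kept exact, since the bare bound
    \<open>2 * (1/2)^n\<close> would not carry the induction on \<open>k\<close>.\<close>
  have far: "d (w z n) (w z (n + k)) \<le> 2 * (1/2)^n - 2 * (1/2)^(n+k)" for z n k
  proof (induction k)
    case (Suc k)
    have "d (w z n) (w z (n + Suc k)) \<le> d (w z n) (w z (n + k)) + d (w z (n + k)) (w z (Suc (n + k)))"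
      using triangle wM by simp
    with Suc step[of z "n + k"] show ?case by simp
  qed (simp add: wM)
  have far': "d (w z n) (w z m) \<le> 2 * (1/2)^n" if "n \<le> m" for z n m
    using far[of z n "m - n"] that by (smt (verit) le_add_diff_inverse zero_le_power divide_nonneg_nonneg)
  have small: "\<exists>n. 4 * (1/2::real)^n < e" if "e > 0" for e
    using real_arch_pow_inv[of "e/4" "1/2"] that by (auto simp: field_simps)
  have "MCauchy (w z)" for z
    unfolding MCauchy_def
  proof (intro conjI allI impI)
    show "range (w z) \<subseteq> M" using wM by auto
    fix e :: real assume "e > 0"
    then obtain N where N: "4 * (1/2::real)^N < e" using small by blast
    have "d (w z n) (w z n') < e" if "N \<le> n" "N \<le> n'" for n n'
      using triangle[OF wM[of z n] wM[of z N] wM[of z n']] far'[of N n z] far'[of N n' z] that N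
        commute[of "w z N"] by simp
    then show "\<exists>N. \<forall>n n'. N \<le> n \<longrightarrow> N \<le> n' \<longrightarrow> d (w z n) (w z n') < e" by blast
  qed
  then have "\<exists>x. limitin mtopology (w z) x sequentially" for z
    using comp unfolding mcomplete_def by blast
  then obtain h where h: "\<And>z. limitin mtopology (w z) (h z) sequentially" by metis
  have hM: "h z \<in> M" for z
    using h limitin_mspace by blast
  have near: "d (w z n) (h z) \<le> 2 * (1/2)^n" for z n
  proof (rule field_le_epsilon)
    fix e :: real assume "e > 0"
    then obtain N where "\<And>m. m \<ge> N \<Longrightarrow> d (w z m) (h z) < e"
      using h[of z] unfolding limit_metric_sequentially by blast
    then have "d (w z (max n N)) (h z) < e" by simp
    then show "d (w z n) (h z) \<le> 2 * (1/2)^n + e"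
      using triangle[OF wM[of z n] wM[of z "max n N"] hM[of z]] far'[of n "max n N" z] by simp
  qed
  \<comment> \<open>Hence on a cylinder of length \<open>n + 1\<close> all values of
    \<open>h\<close> lie within \<open>2 * (1/2)^n\<close> of one common point, which gives
    continuity.\<close>
  have local: "w z' n = w z n" if "\<forall>i\<le>n. z' i = z i" for z z' n
    using that by (induction n) (auto simp: w0 wS)
  have "continuous_map Baire_space mtopology h"
    unfolding continuous_map_to_metric
  proof (intro ballI allI impI)
    fix z :: "nat \<Rightarrow> nat" and e :: real assume "e > 0"
    then obtain n where n: "4 * (1/2::real)^n < e" using small by blast
    have "h z' \<in> mball (h z) e" if "\<forall>i\<le>n. z' i = z i" for z'
      using triangle[OF hM[of z] wM[of z n] hM[of z']] near[of z n] near[of z' n] n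
        commute[of "h z"] local[OF that] hM by simp
    then show "\<exists>U. openin Baire_space U \<and> z \<in> U \<and> (\<forall>y\<in>U. h y \<in> mball (h z) e)"
      using openin_Baire_space_cylinder[of n z] by blast
  qed
  moreover have "range h = M"
  proof (intro equalityI subsetI)
    fix x assume x: "x \<in> M"
    \<comment> \<open>Successive proposals are then at distance below 1/2 + 1/4 times
      \<open>(1/2)^n\<close>, so none is rejected and the walk is the proposed sequence
      itself.\<close>
    have "\<forall>n. \<exists>i. d x (q i) < (1/2)^n / 2" by (intro allI qdense x) simp
    then obtain z where z: "\<And>n. d x (q (z n)) < (1/2)^n / 2" by metis
    have wq: "w z n = q (z n)" for n
    proof (induction n)
      case (Suc n)
      have "d (q (z n)) (q (z (Suc n))) \<le> (1/2)^n"
        using triangle[OF qM[of "z n"] x qM[of "z (Suc n)"]] z[of n] z[of "Suc n"]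
          commute[of x "q (z n)"] zero_le_power[of "1/2 :: real" n]
        by (simp only: power_Suc) linarith
      with Suc show ?case by (simp add: wS)
    qed (simp add: w0)
    have "d x (h z) \<le> 0"
    proof (rule field_le_epsilon)
      fix e :: real assume "e > 0"
      then obtain n where "4 * (1/2::real)^n < e" using small by blast
      then show "d x (h z) \<le> 0 + e"
        using triangle[OF x qM[of "z n"] hM[of z]] z[of n] near[of z n] zero_le_power[of "1/2 :: real" n]
        unfolding wq by linarith
    qed
    then have "x = h z" using mdist_pos_eq[OF x hM[of z]] by linarith
    then show "x \<in> range h" by blast
  qed (use hM in auto)
  ultimately show ?thesis using that by blast
qed

lemma polish_Baire_space_surjection:
  assumes "polish Y" "topspace Y \<noteq> {}"
  obtains h where "continuous_map Baire_space Y h" "range h = topspace Y"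
proof -
  obtain M d where M: "Metric_space M d" "Metric_space.mcomplete M d" "Y = Metric_space.mtopology M d"
    using assms unfolding polish_def completely_metrizable_space_def by blast
  interpret Metric_space M d by (rule M(1))
  show ?thesis
    using Baire_space_surjection M assms that unfolding polish_def
    by (metis topspace_mtopology)
qed

section \<open>A criterion for embedding into the function space\<close>

text \<open>Each \<open>e k\<close> is pulled back along a continuous surjection from the Baire
  space onto \<open>Y\<close>. The fibres stay G-delta, so the result is scatteredly continuous; the
  map from \<open>K\<close> is continuous coordinatewise and injective, hence an embedding of a
  compact space into a Hausdorff one.\<close>

lemma embeds_in_SC\<^sub>p_Baire_space:
  fixes e :: "'a \<Rightarrow> 'b \<Rightarrow> real"
  assumes K: "compact_space K" and Y: "polish Y"
    and cont: "\<And>y. y \<in> topspace Y \<Longrightarrow> continuous_map K euclideanreal (\<lambda>k. e k y)"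
    and val: "\<And>k y. k \<in> topspace K \<Longrightarrow> y \<in> topspace Y \<Longrightarrow> e k y \<in> {0, 1}"
    and gdelta: "\<And>k c. k \<in> topspace K \<Longrightarrow> c \<in> {0, 1} \<Longrightarrow> gdelta_in Y {y \<in> topspace Y. e k y = c}"
    and sep: "\<And>k k'. k \<in> topspace K \<Longrightarrow> k' \<in> topspace K \<Longrightarrow> k \<noteq> k' \<Longrightarrow>
      \<exists>y\<in>topspace Y. e k y \<noteq> e k' y"
  shows "embeds_as_compact_subset K (SC\<^sub>p Baire_space)"
proof -
  have "\<exists>\<Phi>. inj_on \<Phi> (topspace K) \<and> (\<forall>k\<in>topspace K. scatteredly_continuous Baire_space euclideanreal (\<Phi> k))
      \<and> (\<forall>z. continuous_map K euclideanreal (\<lambda>k. \<Phi> k z))"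
  proof (cases "topspace Y = {}")
    \<comment> \<open>No map from the Baire space to \<open>Y\<close> exists here, but
      \<open>sep\<close> leaves at most one point in \<open>K\<close>, and the zero function serves
      as its image.\<close>
    case True
    have "scatteredly_continuous Baire_space euclideanreal (\<lambda>_. 0)"
      by (rule scatteredly_continuous_indicator)
        (use gdelta_in_topspace[of Baire_space] in \<open>auto simp: completely_metrizable_Baire_space\<close>)
    with True sep show ?thesis
      by (intro exI[of _ "\<lambda>_ _. 0"]) (auto simp: inj_on_def)
  next
    case False
    then obtain h where h: "continuous_map Baire_space Y h" "range h = topspace Y"
      using polish_Baire_space_surjection[OF Y] by blast
    have hY: "h z \<in> topspace Y" for z using h(2) by blast
    have "scatteredly_continuous Baire_space euclideanreal (\<lambda>z. e k (h z))" if "k \<in> topspace K" for k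
    proof (rule scatteredly_continuous_indicator)
      fix c :: real assume "c \<in> {0, 1}"
      then show "gdelta_in Baire_space {z \<in> topspace Baire_space. e k (h z) = c}"
        using gdelta_in_continuous_map_preimage[OF h(1) gdelta[OF that]] hY by simp
    qed (use val[OF that] hY in \<open>auto simp: completely_metrizable_Baire_space\<close>)
    moreover have "inj_on (\<lambda>k z. e k (h z)) (topspace K)"
    proof (rule inj_onI, rule ccontr)
      fix k k' assume k: "k \<in> topspace K" "k' \<in> topspace K" "(\<lambda>z. e k (h z)) = (\<lambda>z. e k' (h z))" "k \<noteq> k'"
      then obtain z where "e k (h z) \<noteq> e k' (h z)"
        using sep h(2) by (metis imageE)
      with k(3) show False by metis
    qed
    ultimately show ?thesis
      using cont hY by (intro exI[of _ "\<lambda>k z. e k (h z)"]) auto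
  qed
  then obtain \<Phi> where \<Phi>: "inj_on \<Phi> (topspace K)"
    "\<And>k. k \<in> topspace K \<Longrightarrow> scatteredly_continuous Baire_space euclideanreal (\<Phi> k)"
    "\<And>z. continuous_map K euclideanreal (\<lambda>k. \<Phi> k z)" by blast
  have cm: "continuous_map K (SC\<^sub>p Baire_space) \<Phi>"
    unfolding SC\<^sub>p_def using \<Phi>
    by (auto simp: continuous_map_in_subtopology continuous_map_componentwise_UNIV)
  have "Hausdorff_space (SC\<^sub>p Baire_space)"
    unfolding SC\<^sub>p_def by (auto intro!: Hausdorff_space_subtopology simp: Hausdorff_space_product_topology)
  then have "embedding_map K (SC\<^sub>p Baire_space) \<Phi>"
    using continuous_imp_embedding_map cm K \<Phi>(1) by blast
  then have "K homeomorphic_space subtopology (SC\<^sub>p Baire_space) (\<Phi> ` topspace K)"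
    by (rule embedding_map_imp_homeomorphic_space)
  moreover have "compactin (SC\<^sub>p Baire_space) (\<Phi> ` topspace K)"
    using image_compactin[OF _ cm] K unfolding compact_space_def by blast
  ultimately show ?thesis unfolding embeds_as_compact_subset_def by blast
qed

section \<open>Separating clopen sets at finitely many points\<close>

text \<open>One number bounds both how many points are used and how small the gap may be, so a code
  needs a single integer. The weak inequality makes the condition closed in \<open>f\<close> for
  fixed points and G-delta in the points for fixed Baire-one functions.\<close>

definition apart :: "nat \<Rightarrow> (nat \<Rightarrow> 'x) \<Rightarrow> ('x \<Rightarrow> real) \<Rightarrow> ('x \<Rightarrow> real) \<Rightarrow> bool"
  where "apart n p f g \<longleftrightarrow> (\<exists>l\<le>n. inverse (real (Suc n)) \<le> \<bar>f (p l) - g (p l)\<bar>)"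

lemma apart_commute: "apart n p f g \<longleftrightarrow> apart n p g f"
  unfolding apart_def by (simp add: abs_minus_commute)

text \<open>The product of \<open>U\<close> and its complement is compact and avoids the diagonal,
  so finitely many conditions "the values at \<open>x\<close> differ by more than 1/(m+1)" cover
  it.\<close>

lemma compact_clopen_separation:
  fixes F :: "'a \<Rightarrow> 'b \<Rightarrow> real"
  assumes K: "compact_space K" and X: "X \<noteq> {}"
    and cont: "\<And>x. x \<in> X \<Longrightarrow> continuous_map K euclideanreal (\<lambda>k. F k x)"
    and sep: "\<And>k k'. k \<in> topspace K \<Longrightarrow> k' \<in> topspace K \<Longrightarrow> k \<noteq> k' \<Longrightarrow> \<exists>x\<in>X. F k x \<noteq> F k' x"
    and U: "closedin K U" "openin K U"
  shows "\<exists>n p. range p \<subseteq> X \<and> (\<forall>u\<in>U. \<forall>w\<in>topspace K - U. apart n p (F u) (F w))"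
proof -
  let ?KK = "prod_topology K K" and ?W = "topspace K - U"
  define N where "N x m = {uw \<in> topspace ?KK. \<bar>F (fst uw) x - F (snd uw) x\<bar> \<in> {inverse (Suc m)<..}}"
    for x and m :: nat
  have Nopen: "openin ?KK (N x m)" if "x \<in> X" for x m
    unfolding N_def
  proof (rule openin_continuous_map_preimage)
    show "continuous_map ?KK euclideanreal (\<lambda>uw. \<bar>F (fst uw) x - F (snd uw) x\<bar>)"
      by (intro continuous_map_real_abs continuous_map_diff
          continuous_map_compose[OF continuous_map_fst cont[OF that], unfolded o_def]
          continuous_map_compose[OF continuous_map_snd cont[OF that], unfolded o_def])
  qed simp
  have "compactin ?KK (U \<times> ?W)"
    using closedin_compact_space[OF K] U by (auto simp: compactin_Times)
  moreover have "U \<times> ?W \<subseteq> \<Union>(case_prod N ` (X \<times> UNIV))"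
  proof
    fix uw assume uw: "uw \<in> U \<times> ?W"
    then obtain u w where uw_eq: "uw = (u, w)" and u: "u \<in> U" and w: "w \<in> ?W" by blast
    have uK: "u \<in> topspace K" using u U closedin_subset by blast
    have "u \<noteq> w" using u w by blast
    then obtain x where x: "x \<in> X" "F u x \<noteq> F w x" using sep uK w by blast
    then obtain m where "inverse (Suc m) < \<bar>F u x - F w x\<bar>"
      using reals_Archimedean[of "\<bar>F u x - F w x\<bar>"] by auto
    then have "uw \<in> N x m" using uK w unfolding uw_eq N_def by simp
    with x show "uw \<in> \<Union>(case_prod N ` (X \<times> UNIV))" by blast
  qed
  ultimately obtain \<F> where \<F>: "finite \<F>" "\<F> \<subseteq> case_prod N ` (X \<times> UNIV)" "U \<times> ?W \<subseteq> \<Union>\<F>"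
    using Nopen unfolding compactin_def by (smt (verit) SigmaE imageE case_prod_conv)
  then obtain S where S: "finite S" "S \<subseteq> X \<times> UNIV" "\<F> = case_prod N ` S"
    using finite_subset_image[OF \<F>(1,2)] by metis
  obtain xs where xs: "set xs = fst ` S" using finite_list[OF finite_imageI[OF S(1)]] by metis
  obtain x0 where x0: "x0 \<in> X" using X by (metis ex_in_conv)
  \<comment> \<open>The finite list is padded with \<open>x0\<close> to a full sequence, and
    \<open>n\<close> dominates both its length and every \<open>m\<close> that occurs. The inserted
    0 keeps \<open>Max\<close> meaningful when the subcover is empty.\<close>
  define p where "p l = (if l < length xs then xs ! l else x0)" for l
  define n where "n = length xs + Max (insert 0 (snd ` S))"
  have "range p \<subseteq> X"
    using xs S(2) x0 nth_mem[of _ xs] unfolding p_def by fastforce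
  moreover have "apart n p (F u) (F w)" if "u \<in> U" "w \<in> ?W" for u w
  proof -
    have "(u, w) \<in> \<Union>(case_prod N ` S)" using \<F>(3) S(3) that by blast
    then obtain x m where xm: "(x, m) \<in> S" "(u, w) \<in> N x m" by auto
    then have "x \<in> set xs" using xs by force
    then obtain l where l: "l < length xs" "xs ! l = x" by (metis in_set_conv_nth)
    have "m \<in> insert 0 (snd ` S)" using xm(1) by force
    then have "m \<le> n" using S(1) unfolding n_def by (simp add: trans_le_add2)
    then have "inverse (real (Suc n)) \<le> inverse (Suc m)" by (simp add: field_simps)
    also have "\<dots> < \<bar>F u x - F w x\<bar>" using xm(2) unfolding N_def by simp
    finally have "inverse (real (Suc n)) \<le> \<bar>F u (p l) - F w (p l)\<bar>"
      using l unfolding p_def by simp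
    moreover have "l \<le> n" using l unfolding n_def by simp
    ultimately show ?thesis unfolding apart_def by blast
  qed
  ultimately show ?thesis by blast
qed

lemma closedin_apart:
  assumes "\<And>l. continuous_map K euclideanreal (\<lambda>k. F k (p l))"
  shows "closedin K {k \<in> topspace K. apart n p (F k) g}"
proof -
  have "closedin K {k \<in> topspace K. \<bar>F k (p l) - g (p l)\<bar> \<in> {inverse (real (Suc n))..}}" for l
    by (intro closedin_continuous_map_preimage[where Y = euclideanreal] continuous_map_real_abs
        continuous_map_diff assms) auto
  then have "closedin K (\<Union>l\<in>{..n}. {k \<in> topspace K. \<bar>F k (p l) - g (p l)\<bar> \<in> {inverse (real (Suc n))..}})"
    by (intro closedin_Union) auto
  also have "(\<Union>l\<in>{..n}. {k \<in> topspace K. \<bar>F k (p l) - g (p l)\<bar> \<in> {inverse (real (Suc n))..}})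
      = {k \<in> topspace K. apart n p (F k) g}"
    unfolding apart_def by auto
  finally show ?thesis .
qed

text \<open>Now the functions are fixed and the code varies. The bound \<open>n t\<close> depends on
  \<open>t\<close>, so the condition is an intersection over all \<open>N\<close>: either
  \<open>n t\<close> differs from \<open>N\<close>, or one of finitely many G-delta conditions with
  constant bound \<open>N\<close> holds.\<close>

lemma gdelta_in_apart:
  assumes p: "\<And>l. continuous_map T X (\<lambda>t. p t l)"
    and n: "\<And>N. openin T {t \<in> topspace T. n t \<noteq> (N :: nat)}"
    and fg: "baire_one X f" "baire_one X g"
  shows "gdelta_in T {t \<in> topspace T. apart (n t) (p t) f g}"
proof -
  have "gdelta_in T {t \<in> topspace T. inverse (real (Suc N)) \<le> \<bar>f (p t l) - g (p t l)\<bar>}" for N l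
    by (intro gdelta_in_baire_one_ge baire_one_abs_diff baire_one_compose[OF p] fg)
  then have "gdelta_in T ({t \<in> topspace T. n t \<noteq> N} \<union>
      (\<Union>l\<in>{..N}. {t \<in> topspace T. inverse (real (Suc N)) \<le> \<bar>f (p t l) - g (p t l)\<bar>}))" for N
    using n by (intro gdelta_in_Un gdelta_in_finite_UN) (auto intro: open_imp_gdelta_in)
  then have "gdelta_in T (\<Inter>N. {t \<in> topspace T. n t \<noteq> N} \<union>
      (\<Union>l\<in>{..N}. {t \<in> topspace T. inverse (real (Suc N)) \<le> \<bar>f (p t l) - g (p t l)\<bar>}))"
    by (intro gdelta_in_Inter) auto
  also have "(\<Inter>N. {t \<in> topspace T. n t \<noteq> N} \<union>
      (\<Union>l\<in>{..N}. {t \<in> topspace T. inverse (real (Suc N)) \<le> \<bar>f (p t l) - g (p t l)\<bar>}))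
      = {t \<in> topspace T. apart (n t) (p t) f g}"
    unfolding apart_def by auto
  finally show ?thesis .
qed

lemma continuous_map_indicator_clopen:
  assumes "closedin K {k \<in> topspace K. P k}" "closedin K {k \<in> topspace K. \<not> P k}"
  shows "continuous_map K euclideanreal (\<lambda>k. if P k then 1 else 0)"
proof -
  have "openin K {k \<in> topspace K. \<not> P k}" "openin K {k \<in> topspace K. P k}"
    using openin_diff[OF openin_topspace assms(1)] openin_diff[OF openin_topspace assms(2)]
    by (simp_all add: set_diff_eq cong: conj_cong)
  then have "openin K {k \<in> topspace K. (if P k then 1 else 0::real) \<in> U}" for U
  proof -
    have "{k \<in> topspace K. (if P k then 1 else 0::real) \<in> U} =
      (if 1 \<in> U then {k \<in> topspace K. P k} else {}) \<union> (if 0 \<in> U then {k \<in> topspace K. \<not> P k} else {})"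
      by auto
    then show ?thesis
      using \<open>openin K {k \<in> topspace K. \<not> P k}\<close> \<open>openin K {k \<in> topspace K. P k}\<close> by auto
  qed
  then show ?thesis unfolding continuous_map by auto
qed

section \<open>The Polish space of codes of clopen sets\<close>

lemma embeds_of_dense_sequence:
  fixes F :: "'a \<Rightarrow> 'x \<Rightarrow> real" and d :: "nat \<Rightarrow> 'a"
  assumes K: "compact_space K" and X: "polish X" "topspace X \<noteq> {}"
    and cont: "\<And>x. x \<in> topspace X \<Longrightarrow> continuous_map K euclideanreal (\<lambda>k. F k x)"
    and sep: "\<And>k k'. k \<in> topspace K \<Longrightarrow> k' \<in> topspace K \<Longrightarrow> k \<noteq> k' \<Longrightarrow> \<exists>x\<in>topspace X. F k x \<noteq> F k' x"
    and baire: "\<And>k. k \<in> topspace K \<Longrightarrow> baire_one X (F k)"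
    and base: "has_clopen_base K"
    and d: "range d \<subseteq> topspace K" "K closure_of (range d) = topspace K"
  shows "embeds_as_compact_subset K (SC\<^sub>p Baire_space)"
proof -
  obtain h where h: "continuous_map Baire_space X h" "range h = topspace X"
    using polish_Baire_space_surjection[OF X] by blast
  have dK: "d j \<in> topspace K" for j using d(1) by blast
  define T where "T = (euclidean :: (nat \<Rightarrow> nat \<Rightarrow> nat) topology)"
  have TT [simp]: "topspace T = UNIV" unfolding T_def by simp
  have T_prod: "T = product_topology (\<lambda>_. Baire_space) UNIV"
    unfolding T_def Baire_space_eq_euclidean by (simp add: euclidean_product_topology)
  txt \<open>Row 0 of a code \<open>t\<close> holds \<open>n\<close> and the characteristic function of \<open>J\<close>; row \<open>l + 1\<close> codes the
    point \<open>x\<^sub>l\<close> through \<open>h\<close>. Codes in \<open>G\<close> are those for which \<open>{d j | j \<in> J}\<close> and \<open>{d j | j \<notin> J}\<close> have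
    disjoint closures, as witnessed by \<open>n\<close> and the points.\<close>
  define p where "p t l = h (t (Suc l))" for t :: "nat \<Rightarrow> nat \<Rightarrow> nat" and l
  define n where "n t = t 0 0" for t :: "nat \<Rightarrow> nat \<Rightarrow> nat"
  define J where "J t = {j. t 0 (Suc j) \<noteq> 0}" for t :: "nat \<Rightarrow> nat \<Rightarrow> nat"
  define away where "away J' t f \<longleftrightarrow> (\<forall>j. j \<notin> J' \<longrightarrow> apart (n t) (p t) f (F (d j)))" for J' t f
  define G where "G = {t. \<forall>j\<in>J t. away (J t) t (F (d j))}"
  have p_cont: "continuous_map T X (\<lambda>t. p t l)" for l
    unfolding p_def T_prod
    using continuous_map_compose[OF continuous_map_product_projection[OF UNIV_I, where X = "\<lambda>_. Baire_space"] h(1)]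
    by (simp add: o_def)
  have pX: "p t l \<in> topspace X" for t l using h(2) unfolding p_def by blast
  have op: "openin T {t. t i j \<in> A}" for i j :: nat and A :: "nat set"
  proof -
    have "continuous_map T Baire_space (\<lambda>t. t i)"
      unfolding T_prod by (rule continuous_map_product_projection) simp
    moreover have "continuous_map Baire_space (discrete_topology UNIV) (\<lambda>z. z j)"
      unfolding Baire_space_def by (rule continuous_map_product_projection) simp
    ultimately have "continuous_map T (discrete_topology UNIV) (\<lambda>t. t i j)"
      using continuous_map_compose by (fastforce simp: o_def)
    then have "openin T {t \<in> topspace T. t i j \<in> A}"
      by (rule openin_continuous_map_preimage) simp
    then show ?thesis by simp
  qed
  have apartG: "gdelta_in T {t. apart (n t) (p t) (F k) (F k')}" if "k \<in> topspace K" "k' \<in> topspace K" for k k'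
    using gdelta_in_apart[OF p_cont, of n "F k" "F k'"] op[of 0 0 "- {_}"] baire that unfolding n_def by simp
  have inJ: "gdelta_in T {t. j \<in> J t}" and notinJ: "gdelta_in T {t. j \<notin> J t}" for j
    using op[of 0 "Suc j" "- {0}"] op[of 0 "Suc j" "{0}"] unfolding J_def
    by (simp_all add: open_imp_gdelta_in)
  have away1: "gdelta_in T {t. away (J t) t (F k)}" and away0: "gdelta_in T {t. away (- J t) t (F k)}"
    if k: "k \<in> topspace K" for k
  proof -
    have "gdelta_in T (\<Inter>j. {t. j \<in> J t} \<union> {t. apart (n t) (p t) (F k) (F (d j))})"
      using inJ apartG[OF k dK] by (intro gdelta_in_Inter) (auto intro: gdelta_in_Un)
    moreover have "(\<Inter>j. {t. j \<in> J t} \<union> {t. apart (n t) (p t) (F k) (F (d j))}) = {t. away (J t) t (F k)}"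
      unfolding away_def by auto
    ultimately show "gdelta_in T {t. away (J t) t (F k)}" by simp
    have "gdelta_in T (\<Inter>j. {t. j \<notin> J t} \<union> {t. apart (n t) (p t) (F k) (F (d j))})"
      using notinJ apartG[OF k dK] by (intro gdelta_in_Inter) (auto intro: gdelta_in_Un)
    moreover have "(\<Inter>j. {t. j \<notin> J t} \<union> {t. apart (n t) (p t) (F k) (F (d j))}) = {t. away (- J t) t (F k)}"
      unfolding away_def by auto
    ultimately show "gdelta_in T {t. away (- J t) t (F k)}" by simp
  qed
  have GG: "gdelta_in T G"
  proof -
    have "gdelta_in T (\<Inter>j. {t. j \<notin> J t} \<union> {t. away (J t) t (F (d j))})"
      using notinJ away1[OF dK] by (intro gdelta_in_Inter) (auto intro: gdelta_in_Un)
    moreover have "(\<Inter>j. {t. j \<notin> J t} \<union> {t. away (J t) t (F (d j))}) = G"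
      unfolding G_def by auto
    ultimately show ?thesis by simp
  qed
  have apart_closed: "closedin K {k \<in> topspace K. apart (n t) (p t) (F k) g}" for t g
    by (intro closedin_apart cont pX)
  have away_closed: "closedin K {k \<in> topspace K. away J' t (F k)}" for J' t
  proof -
    have "closedin K {k \<in> topspace K. j \<in> J' \<or> apart (n t) (p t) (F k) (F (d j))}" for j
      using apart_closed by (cases "j \<in> J'") auto
    then have "closedin K (\<Inter>j. {k \<in> topspace K. j \<in> J' \<or> apart (n t) (p t) (F k) (F (d j))})"
      by (intro closedin_Inter) auto
    moreover have "(\<Inter>j. {k \<in> topspace K. j \<in> J' \<or> apart (n t) (p t) (F k) (F (d j))})
        = {k \<in> topspace K. away J' t (F k)}"
      unfolding away_def by auto
    ultimately show ?thesis by simp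
  qed
  \<comment> \<open>Both \<open>away\<close> conditions are closed in \<open>k\<close>. Every
    \<open>d j\<close> satisfies one of them: for \<open>j\<close> in \<open>J t\<close> by the
    definition of \<open>G\<close>, otherwise by symmetry of \<open>apart\<close>. Density extends
    this to all of \<open>K\<close>.\<close>
  have away_or: "away (J t) t (F k) \<or> away (- J t) t (F k)" if "t \<in> G" "k \<in> topspace K" for t k
  proof -
    let ?S = "{k \<in> topspace K. away (J t) t (F k)} \<union> {k \<in> topspace K. away (- J t) t (F k)}"
    have "d j \<in> ?S" for j
    proof (cases "j \<in> J t")
      case True
      then show ?thesis using that(1) dK unfolding G_def by simp
    next
      case False
      have "apart (n t) (p t) (F (d j)) (F (d i))" if "i \<in> J t" for i
        using that \<open>t \<in> G\<close> False apart_commute unfolding G_def away_def by blast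
      then show ?thesis using dK unfolding away_def by simp
    qed
    then have "K closure_of range d \<subseteq> ?S"
      by (intro closure_of_minimal closedin_Un away_closed) auto
    then show ?thesis using d(2) that(2) by blast
  qed
  \<comment> \<open>Such a \<open>k\<close> would be apart from every \<open>d j\<close>, hence by
    density from itself, although the required gap is positive.\<close>
  have not_both: "\<not> (away (J t) t (F k) \<and> away (- J t) t (F k))" if k: "k \<in> topspace K" for t k
  proof
    assume "away (J t) t (F k) \<and> away (- J t) t (F k)"
    then have "range d \<subseteq> {k' \<in> topspace K. apart (n t) (p t) (F k') (F k)}"
      using dK apart_commute[of "n t" "p t" "F k"] unfolding away_def by blast
    then have "K closure_of range d \<subseteq> {k' \<in> topspace K. apart (n t) (p t) (F k') (F k)}"
      by (intro closure_of_minimal apart_closed)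
    then show False using d(2) k unfolding apart_def by auto
  qed
  define e where "e k t = (if away (J t) t (F k) then 1 else 0 :: real)" for k t
  define Y where "Y = subtopology T G"
  have Y [simp]: "topspace Y = G" unfolding Y_def by simp
  have eq1: "{t \<in> G. e k t = 1} = {t. away (J t) t (F k)} \<inter> G" for k
    unfolding e_def by auto
  \<comment> \<open>Failure of an \<open>away\<close> condition is a priori only F-sigma in
    \<open>t\<close>. On \<open>G\<close> it is equivalent to the opposite \<open>away\<close>
    condition, so the 0-fibre is G-delta as well.\<close>
  have eq0: "{t \<in> G. e k t = 0} = {t. away (- J t) t (F k)} \<inter> G" if "k \<in> topspace K" for k
    using away_or[OF _ that] not_both[OF that] unfolding e_def by auto
  show ?thesis
  proof (rule embeds_in_SC\<^sub>p_Baire_space[of K Y e])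
    have "completely_metrizable_space T"
      unfolding T_prod by (simp add: completely_metrizable_space_product_topology completely_metrizable_Baire_space)
    then show "polish Y"
      unfolding Y_def T_def using GG polish_gdelta_in by (simp add: T_def)
    show "continuous_map K euclideanreal (\<lambda>k. e k t)" if "t \<in> topspace Y" for t
    proof -
      \<comment> \<open>The same dichotomy, read in \<open>k\<close> for a fixed code, shows that
        the coded set has a closed complement and is thus clopen.\<close>
      have "{k \<in> topspace K. \<not> away (J t) t (F k)} = {k \<in> topspace K. away (- J t) t (F k)}"
        using away_or not_both that by auto
      then show ?thesis
        unfolding e_def using away_closed[of _ t] by (intro continuous_map_indicator_clopen) simp_all
    qed
    show "e k t \<in> {0, 1}" for k t unfolding e_def by simp
    show "gdelta_in Y {t \<in> topspace Y. e k t = c}" if "k \<in> topspace K" "c \<in> {0, 1}" for k c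
      unfolding Y_def gdelta_in_subtopology using that eq0 eq1 away0 away1 by fastforce
    show "\<exists>t\<in>topspace Y. e k t \<noteq> e k' t"
      if k: "k \<in> topspace K" "k' \<in> topspace K" "k \<noteq> k'" for k k'
    proof -
      obtain x where x: "x \<in> topspace X" "F k x \<noteq> F k' x" using sep k by blast
      have "openin K {a \<in> topspace K. F a x \<in> - {F k' x}}"
        using cont[OF x(1)] by (intro openin_continuous_map_preimage) auto
      moreover have "k \<in> {a \<in> topspace K. F a x \<in> - {F k' x}}" using k x by simp
      moreover obtain \<B> where "\<forall>V\<in>\<B>. openin K V \<and> closedin K V"
        and "\<forall>U a. openin K U \<and> a \<in> U \<longrightarrow> (\<exists>V\<in>\<B>. a \<in> V \<and> V \<subseteq> U)"
        using base unfolding has_clopen_base_def by (elim exE conjE)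
      ultimately obtain U where U: "openin K U" "closedin K U" "k \<in> U"
        "U \<subseteq> {a \<in> topspace K. F a x \<in> - {F k' x}}"
        by meson
      have "\<exists>m q. range q \<subseteq> topspace X \<and> (\<forall>u\<in>U. \<forall>w\<in>topspace K - U. apart m q (F u) (F w))"
        by (rule compact_clopen_separation[OF K X(2) cont sep U(2,1)])
      then obtain m q where q: "range q \<subseteq> topspace X"
        "\<And>u w. u \<in> U \<Longrightarrow> w \<in> topspace K - U \<Longrightarrow> apart m q (F u) (F w)"
        by blast
      have "\<forall>l. \<exists>z. h z = q l" using q(1) h(2) by (metis imageE rangeI subsetD)
      then obtain z where z: "\<And>l. h (z l) = q l" by metis
      \<comment> \<open>The code of \<open>U\<close>: row 0 holds \<open>m\<close> followed by the
        indicator of the \<open>j\<close> with \<open>d j\<close> in \<open>U\<close>, and row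
        \<open>l + 1\<close> is a preimage of \<open>q l\<close> under \<open>h\<close>.\<close>
      define t where "t = case_nat (case_nat m (\<lambda>j. if d j \<in> U then 1 else 0)) z"
      have t: "n t = m" "p t = q" "J t = {j. d j \<in> U}"
        unfolding n_def p_def J_def t_def using z by auto
      have apart: "apart (n t) (p t) (F u) (F w)" if "u \<in> U" "w \<in> topspace K - U" for u w
        using q(2)[OF that] unfolding t .
      have n1: "away (J t) t (F u)" if "u \<in> U" for u
        using apart[OF that] dK unfolding away_def t(3) by simp
      have n0: "away (- J t) t (F w)" if "w \<in> topspace K - U" for w
        using apart[OF _ that] apart_commute unfolding away_def t(3) by fastforce
      have "t \<in> G" unfolding G_def using n1 t(3) by simp
      moreover have "e k t = 1" unfolding e_def using n1 U(3) by simp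
      moreover have "e k' t = 0"
        using n0[of k'] not_both[OF k(2)] k(2) U(4) unfolding e_def by auto
      ultimately show ?thesis by force
    qed
  qed (rule K)
qed

section \<open>From a Rosenthal compactum to a dense sequence of Baire-one functions\<close>

theorem theorem3:
  fixes K :: "'a topology"
  assumes "rosenthal_compact TYPE('x) K"
    and "has_clopen_base K"
    and "separable_space K"
  shows "embeds_as_compact_subset K (SC\<^sub>p Baire_space)"
proof -
  obtain X :: "'x topology" and C where X: "polish X" and C: "compactin (Baire_one_space X) C"
    and hom: "K homeomorphic_space subtopology (Baire_one_space X) C"
    using assms(1) unfolding rosenthal_compact_def embeds_as_compact_subset_def by blast
  have K: "compact_space K"
    using homeomorphic_compact_space[OF hom] C by (simp add: compact_space_subtopology)
  obtain F where F: "homeomorphic_map K (subtopology (Baire_one_space X) C) F"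
    using hom homeomorphic_space by blast
  have inj: "inj_on F (topspace K)" using F homeomorphic_imp_injective_map by blast
  have "continuous_map K (Baire_one_space X) F"
    using homeomorphic_imp_continuous_map[OF F] continuous_map_in_subtopology by blast
  then have Fc: "continuous_map K (powertop_real (topspace X)) F" and Fb: "F ` topspace K \<subseteq> {f. baire_one X f}"
    unfolding Baire_one_space_def by (auto simp: continuous_map_in_subtopology)
  have cont: "continuous_map K euclideanreal (\<lambda>k. F k x)" if "x \<in> topspace X" for x
    using Fc that by (simp add: continuous_map_componentwise)
  \<comment> \<open>Points of the power are \<open>undefined\<close> off \<open>topspace X\<close>,
    so distinct images of points of \<open>K\<close> already differ somewhere on
    \<open>topspace X\<close>.\<close>
  have ext: "F k \<in> extensional (topspace X)" if "k \<in> topspace K" for k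
    using Fc that by (auto simp: continuous_map_componentwise)
  have sep: "\<exists>x\<in>topspace X. F k x \<noteq> F k' x" if "k \<in> topspace K" "k' \<in> topspace K" "k \<noteq> k'" for k k'
  proof (rule ccontr)
    assume "\<not> ?thesis"
    then have "F k = F k'"
      using ext that by (intro extensionalityI[of _ "topspace X"]) auto
    then show False using inj_onD[OF inj] that by blast
  qed
  show ?thesis
  proof (cases "\<exists>k\<in>topspace K. \<exists>k'\<in>topspace K. k \<noteq> k'")
    \<comment> \<open>Two distinct points make both \<open>topspace X\<close> and the dense set
      nonempty, as required for the surjection onto \<open>X\<close> and for enumerating
      \<open>D\<close>.\<close>
    case True
    then have "topspace X \<noteq> {}" using sep by blast
    obtain D where D: "countable D" "D \<subseteq> topspace K" "K closure_of D = topspace K"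
      using assms(3) unfolding separable_space_def by blast
    have "D \<noteq> {}" using True D(3) by auto
    then have "range (from_nat_into D) = D" using range_from_nat_into[OF _ D(1)] by simp
    then show ?thesis
      using D Fb
      by (intro embeds_of_dense_sequence[OF K X \<open>topspace X \<noteq> {}\<close> cont sep _ assms(2), of "from_nat_into D"])
        auto
  next
    \<comment> \<open>With at most one point there is nothing to separate, and the empty Polish
      space meets the criterion.\<close>
    case False
    have "polish (discrete_topology {} :: nat topology)"
      unfolding polish_def by (simp add: completely_metrizable_space_discrete_topology separable_space_discrete_topology)
    with False K show ?thesis
      by (intro embeds_in_SC\<^sub>p_Baire_space[where Y = "discrete_topology {} :: nat topology" and e = "\<lambda>_ _. 0"])
        auto
  qed
qed

end
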